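(* Let $\alpha\in\mathbb{R}$ and let $Z$ be a real random variable with $Z\sim BASLG_2(\alpha)$. Then the cumulative distribution function $F_Z(z;\alpha)=P(Z\le z)$ is given, for every $z\in\mathbb{R}$, by $$F_Z(z;\alpha)=\frac{1}{(1+e^{z})\,C_2(\alpha)}\Big[\big(2+z\alpha(-2+z\alpha)\big)\Big(e^{z}\big(2+z\alpha(-2+z\alpha)\big)-4(1+e^{z})\alpha(-1+z\alpha)\log(1+e^{z})\Big)-4(1+e^{z})\alpha^{2}\Big(\big(4+3z\alpha(-2+z\alpha)\big)\mathrm{Li}_2(-e^{z})+6\alpha\big((1-z\alpha)\mathrm{Li}_3(-e^{z})+\alpha\,\mathrm{Li}_4(-e^{z})\big)\Big)\Big].$$
   Context: For $\alpha\in\mathbb{R}$, $BASLG_2(\alpha)$ (the Balakrishnan alpha skew logistic distribution with skewness parameter $\alpha$) is the continuous distribution on $\mathbb{R}$ with probability density function $$f_Z(z;\alpha)=\frac{[(1-\alpha z)^2+1]^2}{C_2(\alpha)}\,\frac{e^{-z}}{(1+e^{-z})^2},\quad z\in\mathbb{R},\qquad C_2(\alpha)=4+\frac{8\pi^2\alpha^2}{3}+\frac{7\pi^4\alpha^4}{15}.$$ $\log$ is the natural logarithm. $\mathrm{Li}_n$ denotes the polylogarithm function, $\mathrm{Li}_n(x)=\sum_{k=1}^{\infty}x^k/k^n$ for $|x|\le 1$ ($n\geq 2$), extended to all $x\in(-\infty,1]$ by its standard analytic continuation, i.e. $\mathrm{Li}_1(x)=-\log(1-x)$ and $\mathrm{Li}_n(x)=\int_0^x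 \mathrm{Li}_{n-1}(s)\,\frac{ds}{s}$ for $n\ge 2$. *)

theory Defs
  imports "HOL-Probability.Probability"
begin

text \<open>
  Real polylogarithm of natural order on the half-line \<open>x \<le> 1\<close>. The interval integral is oriented,
  so for \<open>x < 0\<close> it is minus the integral over \<open>{x<..<0}\<close>. Order \<open>0\<close> is only there to make the
  function total, with the usual value; for orders at least \<open>2\<close> the power series
  \<open>\<Sum>k. x^(k+1) / (k+1)^n\<close> is the expansion of this function on \<open>{-1..1}\<close>.
\<close>

fun polylog :: "nat \<Rightarrow> real \<Rightarrow> real" where
  "polylog 0 x = x / (1 - x)"
| "polylog (Suc 0) x = - ln (1 - x)"
| "polylog (Suc (Suc n)) x = (LBINT s=ereal 0..ereal x. polylog (Suc n) s / s)"

definition baslg2_const :: "real \<Rightarrow> real" where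
  "baslg2_const \<alpha> = 4 + 8 * pi\<^sup>2 * \<alpha>\<^sup>2 / 3 + 7 * pi ^ 4 * \<alpha> ^ 4 / 15"

definition baslg2_density :: "real \<Rightarrow> real \<Rightarrow> real" where
  "baslg2_density \<alpha> z =
     ((1 - \<alpha> * z)\<^sup>2 + 1)\<^sup>2 / baslg2_const \<alpha> * (exp (- z) / (1 + exp (- z))\<^sup>2)"

end

theory Submission
  imports Defs "HOL-Computational_Algebra.Polynomial"
begin

text \<open>
  The composites \<open>z \<mapsto> Li\<^sub>n(- e\<^sup>z)\<close> form a chain of iterated antiderivatives: differentiating one lowers
  its order, because the factor \<open>1 / x\<close> in the derivative of \<open>Li\<^sub>n\<close> cancels against the inner
  derivative (\<open>polylog_neg_exp_deriv\<close>). The chain starts at \<open>Li\<^sub>0(- e\<^sup>z) = - e\<^sup>z / (1 + e\<^sup>z)\<close>, minus the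
  logistic distribution function, whose derivative is minus the logistic density. A polynomial
  \<open>P\<close> times the logistic density is therefore integrated by repeated integration by parts, always
  differentiating the polynomial factor; the process stops and gives the antiderivative
  \<open>- (\<Sum>k\<le>n. (-1)\<^sup>k P\<^sup>(\<^sup>k\<^sup>)(z) Li\<^sub>k(- e\<^sup>z))\<close> as soon as \<open>n \<ge> deg P\<close> (\<open>logistic_antideriv_deriv\<close>).

  On the negative half-line \<open>\<bar>Li\<^sub>n(x)\<bar> \<le> \<bar>x\<bar>\<close> (\<open>abs_polylog_le\<close>), so every summand is at most a
  polynomial times \<open>e\<^sup>z\<close> and vanishes at \<open>-\<infinity>\<close>. A nonnegative continuous density with an antiderivative
  vanishing at \<open>-\<infinity>\<close> has that antiderivative as its distribution function
  (\<open>cdf_eq_antiderivative\<close>). The claimed formula is the case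
  \<open>P(z) = ((1 - \<alpha> z)\<^sup>2 + 1)\<^sup>2\<close>, \<open>n = 4\<close>, divided by the normalising constant.
\<close>

section \<open>Polylogarithms on the negative half-line\<close>

lemma einterval_ereal_zero: "einterval (ereal x) 0 = {x<..<0}"
  using einterval_eq(1)[of x 0] by (simp add: zero_ereal_def)

lemma set_integrable_one_Ioo: "set_integrable lborel {a<..<b::real} (\<lambda>_. 1::real)"
  unfolding set_integrable_def
  by (cases "a \<le> b") (simp_all add: integrable_indicator_iff less_top[symmetric] emeasure_lborel_Ioo)

text \<open>
  In the recursion for the polylogarithm the integrand is \<open>f s / s\<close> with \<open>f\<close> the polylogarithm of the
  previous order. The bound \<open>\<bar>f x\<bar> \<le> \<bar>x\<bar>\<close> makes it bounded by 1, so the singularity at \<open>0\<close> is harmless.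
  The next two results show that the integral inherits differentiability and the same bound, which is
  what an induction on the order requires.
\<close>

lemma set_integrable_polylog_kernel:
  fixes f :: "real \<Rightarrow> real"
  assumes cont: "continuous_on {..<0} f" and bound: "\<And>x. x < 0 \<Longrightarrow> \<bar>f x\<bar> \<le> \<bar>x\<bar>"
  shows "set_integrable lborel {a<..<0} (\<lambda>s. f s / s)"
proof (rule set_integrable_bound)
  show "set_integrable lborel {a<..<0} (\<lambda>_. 1::real)"
    by (rule set_integrable_one_Ioo)
  have "continuous_on {a<..<0} (\<lambda>s. f s / s)"
    by (intro continuous_intros continuous_on_subset[OF cont]) auto
  then show "set_borel_measurable lborel {a<..<0} (\<lambda>s. f s / s)"
    unfolding set_borel_measurable_def measurable_lborel2
    by (intro borel_measurable_continuous_on_indicator) auto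
  show "AE x in lborel. x \<in> {a<..<0} \<longrightarrow> norm (f x / x) \<le> norm (1::real)"
    using bound by (auto simp: field_simps)
qed

lemma polylog_kernel_integral_bound:
  fixes f :: "real \<Rightarrow> real"
  assumes cont: "continuous_on {..<0} f" and bound: "\<And>x. x < 0 \<Longrightarrow> \<bar>f x\<bar> \<le> \<bar>x\<bar>"
    and "x \<le> 0"
  shows "\<bar>LBINT s=ereal 0..ereal x. f s / s\<bar> \<le> \<bar>x\<bar>"
proof -
  have ii: "set_integrable lborel {x<..<0} (\<lambda>s. f s / s)"
    by (rule set_integrable_polylog_kernel[OF cont bound])
  have "\<bar>LBINT s=ereal 0..ereal x. f s / s\<bar> = \<bar>LBINT s=ereal x..ereal 0. f s / s\<bar>"
    by (subst interval_integral_endpoints_reverse) simp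
  also have "\<dots> \<le> (LBINT s=ereal x..ereal 0. \<bar>f s / s\<bar>)"
    using interval_integral_norm[of "ereal x" "ereal 0" "\<lambda>s. f s / s"] ii \<open>x \<le> 0\<close>
    by (simp add: interval_lebesgue_integrable_def einterval_ereal_zero)
  also have "\<dots> = (LBINT s:{x<..<0}. \<bar>f s / s\<bar>)"
    using \<open>x \<le> 0\<close> by (simp add: interval_lebesgue_integral_def einterval_ereal_zero)
  also have "\<dots> \<le> (LBINT s:{x<..<0}. 1)"
    using bound
    by (intro set_integral_mono set_integrable_abs ii set_integrable_one_Ioo) (auto simp: field_simps)
  also have "\<dots> = \<bar>x\<bar>"
    using \<open>x \<le> 0\<close> by (simp add: set_lebesgue_integral_def)
  finally show ?thesis .
qed

lemma polylog_kernel_integral_deriv: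
  fixes f :: "real \<Rightarrow> real"
  assumes cont: "continuous_on {..<0} f" and bound: "\<And>x. x < 0 \<Longrightarrow> \<bar>f x\<bar> \<le> \<bar>x\<bar>"
    and "x < 0"
  shows "((\<lambda>x. LBINT s=ereal 0..ereal x. f s / s) has_real_derivative f x / x) (at x)"
proof -
  \<comment> \<open>The fundamental theorem is unavailable at the singular endpoint \<open>0\<close>, so the integral is split at
    a point \<open>b\<close> strictly between \<open>x\<close> and \<open>0\<close>; only the part from \<open>b\<close> depends on the upper limit.\<close>
  define a b where "a = x - 1" and "b = x / 2"
  have ab: "a < x" "x < b" "b < 0" using \<open>x < 0\<close> by (auto simp: a_def b_def)
  have "continuous_on {a..b} (\<lambda>s. f s / s)"
    using ab by (intro continuous_intros continuous_on_subset[OF cont]) auto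
  then have "((\<lambda>u. LBINT s=b..u. f s / s) has_vector_derivative f x / x) (at x within {a..b})"
    using ab by (intro interval_integral_FTC2) auto
  then have "((\<lambda>u. LBINT s=b..u. f s / s) has_real_derivative f x / x) (at x)"
    using ab by (simp add: at_within_Icc_at has_real_derivative_iff_has_vector_derivative)
  then have "((\<lambda>u. (LBINT s=0..b. f s / s) + (LBINT s=b..u. f s / s))
      has_real_derivative f x / x) (at x)"
    by (auto intro!: derivative_eq_intros)
  moreover have "(LBINT s=0..b. f s / s) + (LBINT s=b..u. f s / s) = (LBINT s=ereal 0..ereal u. f s / s)"
    if "u \<in> {a<..<b}" for u
  proof -
    have "interval_lebesgue_integrable lborel (ereal u) (ereal 0) (\<lambda>s. f s / s)"
      using set_integrable_polylog_kernel[OF cont bound, of u] that ab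
      by (simp add: interval_lebesgue_integrable_def einterval_ereal_zero)
    moreover have "min 0 (min (ereal b) (ereal u)) = ereal u" "max 0 (max (ereal b) (ereal u)) = ereal 0"
      using that ab by (auto simp: min_def max_def)
    ultimately show ?thesis
      by (subst interval_integral_sum) (auto simp: zero_ereal_def)
  qed
  ultimately show ?thesis
    using ab by (elim has_field_derivative_transform_within_open[where S = "{a<..<b}"]) auto
qed

text \<open>
  Both claims are proved in one induction: the derivative at one order gives the continuity, and the
  bound gives the integrability, of the integrand that defines the next order.
\<close>

lemma polylog_Suc_deriv_and_bound:
  shows "\<forall>x<0. (polylog (Suc n) has_real_derivative polylog n x / x) (at x)"
    and "\<forall>x\<le>0. \<bar>polylog (Suc n) x\<bar> \<le> \<bar>x\<bar>"
proof (induction n)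
  case 0
  {
    case 1
    show ?case by (auto intro!: derivative_eq_intros simp: field_simps)
  next
    case 2
    show ?case using ln_le_minus_one[of "1 - _ :: real"] by (force simp: abs_if)
  }
next
  case (Suc n)
  have cont: "continuous_on {..<0} (polylog (Suc n))"
    using Suc.IH(1) by (intro DERIV_continuous_on) (auto intro: has_field_derivative_at_within)
  have bound: "\<bar>polylog (Suc n) x\<bar> \<le> \<bar>x\<bar>" if "x < 0" for x
    using Suc.IH(2) that by simp
  have eq: "polylog (Suc (Suc n)) = (\<lambda>x. LBINT s=ereal 0..ereal x. polylog (Suc n) s / s)"
    by (simp add: fun_eq_iff)
  {
    case 1
    show ?case unfolding eq
      using polylog_kernel_integral_deriv[OF cont bound] by blast
  next
    case 2
    show ?case unfolding eq
      using polylog_kernel_integral_bound[OF cont bound] by blast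
  }
qed

lemma abs_polylog_le:
  assumes "x \<le> 0"
  shows "\<bar>polylog n x\<bar> \<le> \<bar>x\<bar>"
proof (cases n)
  case 0
  with assms show ?thesis by (simp add: abs_if field_simps)
next
  case (Suc m)
  with assms polylog_Suc_deriv_and_bound(2) show ?thesis by auto
qed

text \<open>
  The substitution \<open>x = - e\<^sup>z\<close> turns \<open>x \<cdot> d/dx\<close> into \<open>d/dz\<close>, so the order drops by one with no extra
  factor. This also covers the step from \<open>Li\<^sub>1(- e\<^sup>z) = - ln (1 + e\<^sup>z)\<close> to \<open>Li\<^sub>0\<close>.
\<close>

lemma polylog_neg_exp_deriv:
  "((\<lambda>z. polylog (Suc n) (- exp z)) has_real_derivative polylog n (- exp z)) (at z)"
proof -
  have "(polylog (Suc n) has_real_derivative polylog n (- exp z) / - exp z) (at (- exp z))"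
    using polylog_Suc_deriv_and_bound(1)[rule_format, of "- exp z" n] by simp
  moreover have "((\<lambda>z. - exp z) has_real_derivative - exp z) (at z)"
    by (auto intro!: derivative_eq_intros)
  ultimately show ?thesis
    using DERIV_chain2[where f = "polylog (Suc n)" and g = "\<lambda>z. - exp z"] by fastforce
qed

lemma polylog_0_neg_exp_deriv:
  "((\<lambda>z. polylog 0 (- exp z)) has_real_derivative - (exp (- z) / (1 + exp (- z))\<^sup>2)) (at z)"
proof -
  have "1 + exp z > 0" by (simp add: add_pos_pos)
  then show ?thesis
    by (auto intro!: derivative_eq_intros
        simp: exp_minus field_simps power2_eq_square)
qed

section \<open>Integrating a polynomial against the logistic density\<close>

text \<open>
  The result of \<open>n\<close> integrations by parts. Starting the sum at order \<open>0\<close> absorbs the boundary term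
  \<open>P(z) e\<^sup>z / (1 + e\<^sup>z)\<close> into the pattern.
\<close>

definition logistic_antideriv :: "nat \<Rightarrow> real poly \<Rightarrow> real \<Rightarrow> real" where
  "logistic_antideriv n p z =
     - (\<Sum>k\<le>n. (- 1) ^ k * poly ((pderiv ^^ k) p) z * polylog k (- exp z))"

lemma higher_pderiv_eq_0:
  fixes p :: "real poly"
  assumes "degree p < n"
  shows "(pderiv ^^ n) p = 0"
  using assms
proof (induction n arbitrary: p)
  case (Suc n)
  then show ?case
    by (cases "degree p = 0")
      (auto simp: funpow_Suc_right degree_pderiv pderiv_eq_0_iff[THEN iffD2] simp del: funpow.simps)
qed auto

text \<open>
  By the product rule the derivative of each summand has two parts, and the part in which the
  polylogarithm is differentiated cancels the other part of the preceding summand. The telescoping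
  leaves the derivative of \<open>Li\<^sub>0\<close> at one end and a remainder with \<open>P\<^sup>(\<^sup>n\<^sup>+\<^sup>1\<^sup>)\<close> at the other.
\<close>

lemma logistic_antideriv_deriv_remainder:
  "(logistic_antideriv n p has_real_derivative
      poly p z * (exp (- z) / (1 + exp (- z))\<^sup>2)
      - (- 1) ^ n * poly ((pderiv ^^ Suc n) p) z * polylog n (- exp z)) (at z)"
proof (induction n)
  case 0
  show ?case
    unfolding logistic_antideriv_def
    by (auto intro!: derivative_eq_intros polylog_0_neg_exp_deriv simp del: polylog.simps)
next
  case (Suc n)
  have eq: "logistic_antideriv (Suc n) p = (\<lambda>z. logistic_antideriv n p z
      - (- 1) ^ Suc n * poly ((pderiv ^^ Suc n) p) z * polylog (Suc n) (- exp z))"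
    by (simp add: logistic_antideriv_def fun_eq_iff)
  show ?case
    unfolding eq
    by (rule derivative_eq_intros Suc.IH poly_DERIV polylog_neg_exp_deriv refl)+
      (simp add: algebra_simps)
qed

lemma logistic_antideriv_deriv:
  assumes "degree p \<le> n"
  shows "(logistic_antideriv n p has_real_derivative
           poly p z * (exp (- z) / (1 + exp (- z))\<^sup>2)) (at z)"
  using logistic_antideriv_deriv_remainder[of n p z] higher_pderiv_eq_0[of p "Suc n"] assms
  by (simp del: funpow.simps)

lemma tendsto_poly_mult_exp_at_bot:
  fixes p :: "real poly"
  shows "((\<lambda>z. poly p z * exp z) \<longlongrightarrow> 0) at_bot"
proof -
  have "((\<lambda>z. \<Sum>i\<le>degree p. coeff p i * (- 1) ^ i * (z ^ i / exp z)) \<longlongrightarrow>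
      (\<Sum>i\<le>degree p. coeff p i * (- 1) ^ i * 0)) at_top"
    by (intro tendsto_intros tendsto_power_div_exp_0)
  moreover have "(\<Sum>i\<le>degree p. coeff p i * (- 1) ^ i * (z ^ i / exp z)) = poly p (- z) * exp (- z)" for z
    unfolding poly_altdef sum_distrib_right
    by (intro sum.cong) (simp_all add: power_minus[of z] exp_minus divide_inverse)
  ultimately have "((\<lambda>z. poly p (- z) * exp (- z)) \<longlongrightarrow> 0) at_top"
    by simp
  then show ?thesis
    by (simp add: filterlim_at_bot_mirror)
qed

lemma logistic_antideriv_at_bot: "(logistic_antideriv n p \<longlongrightarrow> 0) at_bot"
proof -
  have "((\<lambda>z. poly q z * polylog k (- exp z)) \<longlongrightarrow> 0) at_bot" for q k
  proof (rule Lim_null_comparison)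
    show "\<forall>\<^sub>F z in at_bot. norm (poly q z * polylog k (- exp z)) \<le> \<bar>poly q z * exp z\<bar>"
      using abs_polylog_le[of "- exp _" k] by (auto simp: abs_mult intro!: mult_left_mono always_eventually)
    show "((\<lambda>z. \<bar>poly q z * exp z\<bar>) \<longlongrightarrow> 0) at_bot"
      using tendsto_poly_mult_exp_at_bot by (rule tendsto_rabs_zero)
  qed
  then have "((\<lambda>z. - (\<Sum>k\<le>n. (- 1) ^ k * (poly ((pderiv ^^ k) p) z * polylog k (- exp z)))) \<longlongrightarrow>
      - (\<Sum>k\<le>n. (- 1) ^ k * 0)) at_bot"
    by (intro tendsto_intros)
  then show ?thesis
    by (simp add: logistic_antideriv_def[abs_def] mult.assoc)
qed

section \<open>Distribution functions from antiderivatives\<close>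

text \<open>
  For a nonnegative integrand the fundamental theorem of calculus on an unbounded interval yields
  integrability along with the value of the integral, so it suffices to know the limit of \<open>F\<close> at \<open>-\<infinity>\<close>.
\<close>

lemma cdf_eq_antiderivative:
  fixes f F :: "real \<Rightarrow> real"
  assumes dist: "distributed M lborel Z (\<lambda>t. ennreal (f t))"
    and nonneg: "\<And>t. 0 \<le> f t"
    and cont: "continuous_on UNIV f"
    and deriv: "\<And>t. (F has_real_derivative f t) (at t)"
    and lim: "(F \<longlongrightarrow> 0) at_bot"
  shows "cdf (distr M borel Z) z = F z"
proof -
  have lim_z: "(F \<longlongrightarrow> F z) (at_left z)"
    using DERIV_isCont[OF deriv, of z] unfolding isCont_def by (rule tendsto_within_subset) auto
  have ftc: "set_integrable lborel (einterval (-\<infinity>) (ereal z)) f"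
    "(LBINT x=-\<infinity>..ereal z. f x) = F z - 0"
    using deriv nonneg lim lim_z cont
    by (intro interval_integral_FTC_nonneg[where F = F and A = 0 and B = "F z"];
        auto simp: ereal_tendsto_simps continuous_on_eq_continuous_at)+
  have e: "einterval (-\<infinity>) (ereal z) = {..<z}" by (auto simp: einterval_iff)
  \<comment> \<open>The target measures \<open>borel\<close> and \<open>lborel\<close> of the two push-forwards have the same measurable sets.\<close>
  have "distr M borel Z = density lborel (\<lambda>t. ennreal (f t))"
    using distributed_distr_eq_density[OF dist] distr_cong[of M M borel lborel Z Z] by simp
  then have "emeasure (distr M borel Z) {..z} = (\<integral>\<^sup>+t. ennreal (f t) * indicator {..z} t \<partial>lborel)"
    using distributed_borel_measurable[OF dist] by (simp add: emeasure_density)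
  also have "\<dots> = (\<integral>\<^sup>+t. ennreal (indicator {..<z} t *\<^sub>R f t) \<partial>lborel)"
    using AE_lborel_singleton[of z]
    by (intro nn_integral_cong_AE) (auto split: split_indicator)
  also have "\<dots> = ennreal (LBINT t:{..<z}. f t)"
    using ftc(1) nonneg unfolding e set_integrable_def set_lebesgue_integral_def
    by (intro nn_integral_eq_integral) auto
  also have "(LBINT t:{..<z}. f t) = F z"
    using ftc(2) by (simp add: interval_lebesgue_integral_def e)
  finally have "emeasure (distr M borel Z) {..z} = ennreal (F z)" .
  \<comment> \<open>\<open>ennreal\<close> truncates negative numbers to \<open>0\<close>, hence nonnegativity is needed to recover \<open>F z\<close>.\<close>
  moreover have "0 \<le> F z"
    unfolding ftc(2)[simplified, symmetric] using nonneg
    by (simp add: interval_lebesgue_integral_def set_lebesgue_integral_def)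
  ultimately show ?thesis
    by (simp add: cdf_def measure_def)
qed

section \<open>The Balakrishnan alpha skew logistic distribution\<close>

lemma baslg2_const_pos: "0 < baslg2_const \<alpha>"
  unfolding baslg2_const_def by (intro add_pos_nonneg divide_nonneg_nonneg mult_nonneg_nonneg) auto

lemma baslg2_density_nonneg: "0 \<le> baslg2_density \<alpha> t"
  unfolding baslg2_density_def using baslg2_const_pos[of \<alpha>] by simp

lemma one_plus_exp_neq_0: "1 + exp (t::real) \<noteq> 0"
  by (simp add: add_nonneg_eq_0_iff)

definition baslg2_poly :: "real \<Rightarrow> real poly" where
  "baslg2_poly \<alpha> = [:2, - 2 * \<alpha>, \<alpha>\<^sup>2:]\<^sup>2"

lemma baslg2_density_eq_poly:
  "baslg2_density \<alpha> t = poly (baslg2_poly \<alpha>) t * (exp (- t) / (1 + exp (- t))\<^sup>2) / baslg2_const \<alpha>"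
proof -
  have "(1 - \<alpha> * t)\<^sup>2 + 1 = poly [:2, - 2 * \<alpha>, \<alpha>\<^sup>2:] t"
    by (simp add: power2_eq_square algebra_simps)
  then show ?thesis by (simp add: baslg2_density_def baslg2_poly_def poly_power)
qed

theorem theorem1:
  fixes M :: "'a measure" and Z :: "'a \<Rightarrow> real" and \<alpha> z :: real
  assumes "prob_space M"
    and "distributed M lborel Z (\<lambda>t. ennreal (baslg2_density \<alpha> t))"
  shows "cdf (distr M borel Z) z =
    1 / ((1 + exp z) * baslg2_const \<alpha>) *
    ((2 + z * \<alpha> * (- 2 + z * \<alpha>)) *
       (exp z * (2 + z * \<alpha> * (- 2 + z * \<alpha>))
        - 4 * (1 + exp z) * \<alpha> * (- 1 + z * \<alpha>) * ln (1 + exp z))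
     - 4 * (1 + exp z) * \<alpha>\<^sup>2 *
       ((4 + 3 * z * \<alpha> * (- 2 + z * \<alpha>)) * polylog 2 (- exp z)
        + 6 * \<alpha> * ((1 - z * \<alpha>) * polylog 3 (- exp z) + \<alpha> * polylog 4 (- exp z))))"
proof -
  let ?p = "baslg2_poly \<alpha>" and ?C = "baslg2_const \<alpha>"
  have p: "?p = [:4, - 8 * \<alpha>, 8 * \<alpha>\<^sup>2, - 4 * \<alpha> ^ 3, \<alpha> ^ 4:]"
    by (simp add: baslg2_poly_def power2_eq_square power3_eq_cube power4_eq_xxxx)
  have "degree ?p \<le> 4" by (simp add: p)
  then have deriv: "((\<lambda>t. logistic_antideriv 4 ?p t / ?C) has_real_derivative baslg2_density \<alpha> t) (at t)" for t
    unfolding baslg2_density_eq_poly by (intro DERIV_cdivide logistic_antideriv_deriv)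
  have cont: "continuous_on UNIV (baslg2_density \<alpha>)"
    unfolding baslg2_density_def[abs_def]
    using baslg2_const_pos[of \<alpha>]
    by (intro continuous_intros ballI) (auto simp: one_plus_exp_neq_0)
  have lim: "((\<lambda>t. logistic_antideriv 4 ?p t / ?C) \<longlongrightarrow> 0) at_bot"
    using tendsto_divide_zero[OF logistic_antideriv_at_bot] .
  have "cdf (distr M borel Z) z = logistic_antideriv 4 ?p z / ?C"
    by (rule cdf_eq_antiderivative[OF assms(2) baslg2_density_nonneg cont deriv lim])
  also have "\<dots> = 1 / ((1 + exp z) * ?C) * ((1 + exp z) * logistic_antideriv 4 ?p z)"
    by (simp add: one_plus_exp_neq_0)
  also have "(1 + exp z) * logistic_antideriv 4 ?p z =
    (2 + z * \<alpha> * (- 2 + z * \<alpha>)) *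
       (exp z * (2 + z * \<alpha> * (- 2 + z * \<alpha>))
        - 4 * (1 + exp z) * \<alpha> * (- 1 + z * \<alpha>) * ln (1 + exp z))
     - 4 * (1 + exp z) * \<alpha>\<^sup>2 *
       ((4 + 3 * z * \<alpha> * (- 2 + z * \<alpha>)) * polylog 2 (- exp z)
        + 6 * \<alpha> * ((1 - z * \<alpha>) * polylog 3 (- exp z) + \<alpha> * polylog 4 (- exp z)))"
  proof -
    \<comment> \<open>With \<open>q = (1 - \<alpha> z)\<^sup>2 + 1\<close> and \<open>P = q\<^sup>2\<close>, the coefficients below are \<open>P' = 2 q q'\<close>,
      \<open>P'' = 2 q'\<^sup>2 + 2 q q''\<close>, \<open>P'''\<close> and \<open>P''''\<close> in factored form, with the signs of the antiderivative
      and of \<open>Li\<^sub>1(- e\<^sup>z) = - ln (1 + e\<^sup>z)\<close>.\<close>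
    have "(1 + exp z) * polylog 0 (- exp z) = - exp z" by (simp add: one_plus_exp_neq_0)
    moreover have "logistic_antideriv 4 ?p z =
      - (poly ?p z * polylog 0 (- exp z)
         + (- 4 * \<alpha> * (1 - \<alpha> * z) * (2 - 2 * \<alpha> * z + \<alpha>\<^sup>2 * z\<^sup>2)) * ln (1 + exp z)
         + 4 * \<alpha>\<^sup>2 * (4 + 3 * z * \<alpha> * (- 2 + z * \<alpha>)) * polylog 2 (- exp z)
         + 24 * \<alpha> ^ 3 * (1 - z * \<alpha>) * polylog 3 (- exp z)
         + 24 * \<alpha> ^ 4 * polylog 4 (- exp z))"
    proof -
      have d: "(pderiv ^^ 0) ?p = ?p"
        "(pderiv ^^ 1) ?p = [:- 8 * \<alpha>, 16 * \<alpha>\<^sup>2, - 12 * \<alpha> ^ 3, 4 * \<alpha> ^ 4:]"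
        "(pderiv ^^ 2) ?p = [:16 * \<alpha>\<^sup>2, - 24 * \<alpha> ^ 3, 12 * \<alpha> ^ 4:]"
        "(pderiv ^^ 3) ?p = [:- 24 * \<alpha> ^ 3, 24 * \<alpha> ^ 4:]"
        "(pderiv ^^ 4) ?p = [:24 * \<alpha> ^ 4:]"
        by (simp_all add: p eval_nat_numeral pderiv_pCons del: power_Suc)
      have L1: "polylog 1 (- exp z) = - ln (1 + exp z)" by simp
      have sum: "(\<Sum>k\<le>4. g k) = g 0 + g 1 + g 2 + g 3 + g 4" for g :: "nat \<Rightarrow> real"
        by (simp add: eval_nat_numeral)
      show ?thesis
        unfolding logistic_antideriv_def sum d L1
        by (simp add: algebra_simps power2_eq_square power3_eq_cube power4_eq_xxxx del: polylog.simps)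
    qed
    moreover have "poly ?p z = (2 + z * \<alpha> * (- 2 + z * \<alpha>))\<^sup>2"
      by (simp add: baslg2_poly_def poly_power power2_eq_square algebra_simps)
    ultimately show ?thesis
      by algebra
  qed
  finally show ?thesis .
qed

end
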